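(* For PPSC under the linear threshold model, given a finite set of scenarios $\Omega$, the master problem formulation and the deterministic equivalent formulation (both defined in the context) can each be reduced to the following formulation in $(x,z)$-space: $$\begin{aligned}\min\ &\sum_{i\in V_1}b_ix_i\\ \text{s.t. }&\sum_{i\in V_1}\sigma_\omega(\{i\})x_i\ge\tau z_\omega\quad\forall\omega\in\Omega,\\ &\sum_{\omega\in\Omega}p_\omega z_\omega\ge1-\epsilon,\\ &x\in\{0,1\}^n,\ z\in\{0,1\}^{|\Omega|}.\end{aligned}$$ That is, for every $(x,z)\in\{0,1\}^n\times\{0,1\}^{|\Omega|}$ the following are equivalent: $(x,z)$ is feasible for this formulation; there exists $\theta$ such that $(x,\theta,z)$ is feasible for the master problem; there exists $y$ such that $(x,y,z)$ is feasible for the deterministic equivalent formulation. (All three problems have the same objective $\sum_{i\in V_1}b_ix_i$.)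
   Context: $V_1=\{1,\dots,n\}$ (sets), $V_2=\{1,\dots,m\}$ (items). For each scenario $\omega$ in the finite set $\Omega$, with probability $p_\omega$, $G_\omega=(V_1\cup V_2,E_\omega)$ is a bipartite directed graph (live-arc graph) with arcs from $V_1$ to $V_2$. For the linear threshold model, in every live-arc graph $G_\omega$ each node of $V_2$ has at most one incoming arc. For $i\in V_2$ and $j\in V_1$, $t_{ij}^\omega=1$ if there is an arc from $j$ to $i$ in $E_\omega$, and $t_{ij}^\omega=0$ otherwise. For $S\subseteq V_1$, $\sigma_\omega(S)$ is the number of nodes of $V_2$ having an incoming arc in $E_\omega$ from some node of $S$, and $\rho_j^\omega(S)=\sigma_\omega(S\cup\{j\})-\sigma_\omega(S)$ for $j\in V_1\setminus S$. Data: costs $b_i$, $i\in V_1$; target number of covered items $\tau\le m$; risk level $\epsilon\in[0,1]$. Master problem (with the submodular feasibility cuts): minimize $\sum_{i\in V_1}b_ix_i$ subject to $\theta_\omega\le\sigma_\omega(\bar X)+\sum_{j\in V_1\setminus\bar X}\rho_j^\omega(\bar X)x_j$ for all $\bar X\subseteq V_1$ and $\omega\in\Omega$; $\theta_\omega\ge\tau z_\omega$ for all $\omega\in\Omega$; $\sum_{\omega\in\Omega}p_\omega z_\omega\ge1-\epsilon$; $x\in\{0,1\}^n$, $z\in\{0,1\}^{|\Omega|}$, $\theta\in\mathbb{R}_+^{|\Omega|}$. Deterministic equivalent formulation: minimize $\sum_{j\in V_1}b_jx_j$ subject to $\sum_{j\in V_1}t_{ij}^\omega x_j\ge y_i^\omega$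 for all $i\in V_2$, $\omega\in\Omega$; $\sum_{i\in V_2}y_i^\omega\ge\tau z_\omega$ for all $\omega\in\Omega$; $\sum_{\omega\in\Omega}p_\omega z_\omega\ge1-\epsilon$; $x\in\{0,1\}^n$, $y\in\{0,1\}^{m\times|\Omega|}$, $z\in\{0,1\}^{|\Omega|}$. *)

theory Defs
  imports Complex_Main "HOL-Library.FuncSet"
begin

(* V1 = {1..n} and V2 = {1..m} are disjoint as node sets although both are numbered from 1: an arc
   is a pair (j, i) whose first component always names a node j of V1 and whose second component
   always names a node i of V2. The set E w contains the arcs of the live-arc graph of scenario w. *)

definition bipartite_arcs :: "nat \<Rightarrow> nat \<Rightarrow> (nat \<times> nat) set \<Rightarrow> bool" where
  "bipartite_arcs n m A \<longleftrightarrow> A \<subseteq> {1..n} \<times> {1..m}"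

(* The property of the live-arc graphs of the linear threshold model. *)
definition at_most_one_incoming :: "nat \<Rightarrow> (nat \<times> nat) set \<Rightarrow> bool" where
  "at_most_one_incoming m A \<longleftrightarrow> (\<forall>i\<in>{1..m}. card {a \<in> A. snd a = i} \<le> 1)"

definition arc_ind :: "('w \<Rightarrow> (nat \<times> nat) set) \<Rightarrow> 'w \<Rightarrow> nat \<Rightarrow> nat \<Rightarrow> real" where
  "arc_ind E \<omega> i j = (if (j, i) \<in> E \<omega> then 1 else 0)"

definition sigma :: "nat \<Rightarrow> ('w \<Rightarrow> (nat \<times> nat) set) \<Rightarrow> 'w \<Rightarrow> nat set \<Rightarrow> nat" where
  "sigma m E \<omega> S = card {i \<in> {1..m}. \<exists>j\<in>S. (j, i) \<in> E \<omega>}"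

definition rho :: "nat \<Rightarrow> ('w \<Rightarrow> (nat \<times> nat) set) \<Rightarrow> 'w \<Rightarrow> nat \<Rightarrow> nat set \<Rightarrow> real" where
  "rho m E \<omega> j S = real (sigma m E \<omega> (S \<union> {j})) - real (sigma m E \<omega> S)"

(* A vector indexed by I with entries in D is an element of I \<rightarrow>\<^sub>E D, so that the vectors correspond
   exactly to the points of D^I. *)

definition chance_constraint :: "'w set \<Rightarrow> ('w \<Rightarrow> real) \<Rightarrow> real \<Rightarrow> ('w \<Rightarrow> real) \<Rightarrow> bool" where
  "chance_constraint \<Omega> p \<epsilon> z \<longleftrightarrow> (\<Sum>\<omega>\<in>\<Omega>. p \<omega> * z \<omega>) \<ge> 1 - \<epsilon>"

definition master_feasible ::
  "nat \<Rightarrow> nat \<Rightarrow> 'w set \<Rightarrow> ('w \<Rightarrow> real) \<Rightarrow> ('w \<Rightarrow> (nat \<times> nat) set) \<Rightarrow> nat \<Rightarrow> real \<Rightarrow>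
   ((nat \<Rightarrow> real) \<times> ('w \<Rightarrow> real) \<times> ('w \<Rightarrow> real)) set" where
  "master_feasible n m \<Omega> p E \<tau> \<epsilon> = {(x, \<theta>, z).
     (\<forall>X. X \<subseteq> {1..n} \<longrightarrow> (\<forall>\<omega>\<in>\<Omega>.
        \<theta> \<omega> \<le> real (sigma m E \<omega> X) + (\<Sum>j\<in>{1..n} - X. rho m E \<omega> j X * x j))) \<and>
     (\<forall>\<omega>\<in>\<Omega>. \<theta> \<omega> \<ge> real \<tau> * z \<omega>) \<and>
     chance_constraint \<Omega> p \<epsilon> z \<and>
     x \<in> {1..n} \<rightarrow>\<^sub>E {0, 1} \<and> z \<in> \<Omega> \<rightarrow>\<^sub>E {0, 1} \<and> \<theta> \<in> \<Omega> \<rightarrow>\<^sub>E {0..}}"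

definition det_equiv_feasible ::
  "nat \<Rightarrow> nat \<Rightarrow> 'w set \<Rightarrow> ('w \<Rightarrow> real) \<Rightarrow> ('w \<Rightarrow> (nat \<times> nat) set) \<Rightarrow> nat \<Rightarrow> real \<Rightarrow>
   ((nat \<Rightarrow> real) \<times> (nat \<times> 'w \<Rightarrow> real) \<times> ('w \<Rightarrow> real)) set" where
  "det_equiv_feasible n m \<Omega> p E \<tau> \<epsilon> = {(x, y, z).
     (\<forall>i\<in>{1..m}. \<forall>\<omega>\<in>\<Omega>. (\<Sum>j\<in>{1..n}. arc_ind E \<omega> i j * x j) \<ge> y (i, \<omega>)) \<and>
     (\<forall>\<omega>\<in>\<Omega>. (\<Sum>i\<in>{1..m}. y (i, \<omega>)) \<ge> real \<tau> * z \<omega>) \<and>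
     chance_constraint \<Omega> p \<epsilon> z \<and>
     x \<in> {1..n} \<rightarrow>\<^sub>E {0, 1} \<and> y \<in> {1..m} \<times> \<Omega> \<rightarrow>\<^sub>E {0, 1} \<and> z \<in> \<Omega> \<rightarrow>\<^sub>E {0, 1}}"

definition reduced_feasible ::
  "nat \<Rightarrow> nat \<Rightarrow> 'w set \<Rightarrow> ('w \<Rightarrow> real) \<Rightarrow> ('w \<Rightarrow> (nat \<times> nat) set) \<Rightarrow> nat \<Rightarrow> real \<Rightarrow>
   ((nat \<Rightarrow> real) \<times> ('w \<Rightarrow> real)) set" where
  "reduced_feasible n m \<Omega> p E \<tau> \<epsilon> = {(x, z).
     (\<forall>\<omega>\<in>\<Omega>. (\<Sum>i\<in>{1..n}. real (sigma m E \<omega> {i}) * x i) \<ge> real \<tau> * z \<omega>) \<and>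
     chance_constraint \<Omega> p \<epsilon> z \<and>
     x \<in> {1..n} \<rightarrow>\<^sub>E {0, 1} \<and> z \<in> \<Omega> \<rightarrow>\<^sub>E {0, 1}}"

definition master_objective ::
  "nat \<Rightarrow> (nat \<Rightarrow> real) \<Rightarrow> (nat \<Rightarrow> real) \<times> ('w \<Rightarrow> real) \<times> ('w \<Rightarrow> real) \<Rightarrow> real" where
  "master_objective n b = (\<lambda>(x, \<theta>, z). \<Sum>i\<in>{1..n}. b i * x i)"

definition det_equiv_objective ::
  "nat \<Rightarrow> (nat \<Rightarrow> real) \<Rightarrow> (nat \<Rightarrow> real) \<times> (nat \<times> 'w \<Rightarrow> real) \<times> ('w \<Rightarrow> real) \<Rightarrow> real" where
  "det_equiv_objective n b = (\<lambda>(x, y, z). \<Sum>j\<in>{1..n}. b j * x j)"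

definition reduced_objective ::
  "nat \<Rightarrow> (nat \<Rightarrow> real) \<Rightarrow> (nat \<Rightarrow> real) \<times> ('w \<Rightarrow> real) \<Rightarrow> real" where
  "reduced_objective n b = (\<lambda>(x, z). \<Sum>i\<in>{1..n}. b i * x i)"

end

theory Submission
  imports Defs
begin

text \<open>
  In the linear threshold model the sets of items reached from distinct nodes of \<open>V\<^sub>1\<close> are disjoint,
  since an item has at most one incoming arc. Coverage is therefore not merely submodular but
  additive (\<open>sigma_eq_sum_singletons\<close>), and all three problems turn out to compare \<open>\<tau> z\<^sub>\<omega>\<close> with the
  single linear form \<open>L\<^sub>\<omega>(x) = \<Sum>\<^sub>j \<sigma>\<^sub>\<omega>({j}) x\<^sub>j\<close>.

  For the master problem, additivity turns the cut of a set \<open>X\<close> into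
  \<open>\<theta>\<^sub>\<omega> \<le> (\<Sum>\<^sub>j\<^sub>\<in>\<^sub>X \<sigma>\<^sub>\<omega>({j})) + (\<Sum>\<^sub>j\<^sub>\<notin>\<^sub>X \<sigma>\<^sub>\<omega>({j}) x\<^sub>j)\<close>. As \<open>x \<le> 1\<close>, its right-hand side is at least
  \<open>L\<^sub>\<omega>(x)\<close>, and it equals \<open>L\<^sub>\<omega>(x)\<close> for \<open>X = \<emptyset>\<close>: the cut of the empty set dominates all others, and
  \<open>\<theta> = L(x)\<close> is the largest feasible choice (\<open>linear_form_le_cut\<close>, \<open>cut_empty\<close>).

  For the deterministic equivalent, \<open>\<Sum>\<^sub>j t\<^sub>i\<^sub>j\<^sup>\<omega> x\<^sub>j\<close> has at most one nonzero term and so is itself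
  binary (\<open>arc_sum_binary\<close>). Hence \<open>y\<^sub>i\<^sup>\<omega> = \<Sum>\<^sub>j t\<^sub>i\<^sub>j\<^sup>\<omega> x\<^sub>j\<close> is the largest feasible choice, and
  exchanging the order of summation gives \<open>\<Sum>\<^sub>i y\<^sub>i\<^sup>\<omega> = L\<^sub>\<omega>(x)\<close> (\<open>sum_arc_sums\<close>).
\<close>

text \<open>
  Bipartiteness places \<open>i\<close> among the items, and it makes the arc set finite: the cardinality of an
  infinite set is \<open>0\<close>, so the bound on the number of incoming arcs of \<open>i\<close> forbids two of them only
  together with finiteness.
\<close>

lemma incoming_arc_unique:
  assumes "bipartite_arcs n m A" "at_most_one_incoming m A"
    and "(j, i) \<in> A" "(k, i) \<in> A"
  shows "j = k"
proof -
  have sub: "A \<subseteq> {1..n} \<times> {1..m}"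
    using assms(1) by (simp add: bipartite_arcs_def)
  then have "finite {a \<in> A. snd a = i}"
    using finite_subset[OF sub] by simp
  moreover have "card {a \<in> A. snd a = i} \<le> Suc 0"
    using sub assms(2,3) by (auto simp: at_most_one_incoming_def)
  ultimately show ?thesis
    using assms(3,4) by (auto simp: card_le_Suc0_iff_eq)
qed

text \<open>
  An item covered by two different nodes of \<open>S\<close> would have two incoming arcs, so the items are
  partitioned by the node that covers them.
\<close>

lemma sigma_eq_sum_singletons:
  assumes "bipartite_arcs n m (E \<omega>)" "at_most_one_incoming m (E \<omega>)" "finite S"
  shows "sigma m E \<omega> S = (\<Sum>j\<in>S. sigma m E \<omega> {j})"
proof -
  define I where "I j = {i \<in> {1..m}. (j, i) \<in> E \<omega>}" for j
  have "{i \<in> {1..m}. \<exists>j\<in>S. (j, i) \<in> E \<omega>} = (\<Union>j\<in>S. I j)"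
    by (auto simp: I_def)
  moreover have "card (\<Union>j\<in>S. I j) = (\<Sum>j\<in>S. card (I j))"
    using incoming_arc_unique[OF assms(1,2)] assms(3)
    by (intro card_UN_disjoint) (auto simp: I_def)
  ultimately show ?thesis
    by (simp add: sigma_def I_def)
qed

lemma rho_eq_sigma_singleton:
  assumes "bipartite_arcs n m (E \<omega>)" "at_most_one_incoming m (E \<omega>)" "finite X" "j \<notin> X"
  shows "rho m E \<omega> j X = real (sigma m E \<omega> {j})"
  using assms(3,4)
  by (simp add: rho_def
      sigma_eq_sum_singletons[where E = E and \<omega> = \<omega> and S = "insert j X", OF assms(1,2)]
      sigma_eq_sum_singletons[where E = E and \<omega> = \<omega> and S = X, OF assms(1,2)])

text \<open>
  Replacing \<open>x\<^sub>j\<close> by its upper bound \<open>1\<close> for \<open>j \<in> X\<close>, and leaving it alone elsewhere, turns the linear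
  form into the right-hand side of the cut of \<open>X\<close>.
\<close>

lemma linear_form_le_cut:
  fixes x :: "nat \<Rightarrow> real"
  assumes "bipartite_arcs n m (E \<omega>)" "at_most_one_incoming m (E \<omega>)"
    and X: "X \<subseteq> {1..n}" and x: "\<And>j. j \<in> {1..n} \<Longrightarrow> x j \<le> 1"
  shows "(\<Sum>j\<in>{1..n}. real (sigma m E \<omega> {j}) * x j)
    \<le> real (sigma m E \<omega> X) + (\<Sum>j\<in>{1..n} - X. rho m E \<omega> j X * x j)"
proof -
  have fin: "finite X"
    using X finite_subset by blast
  have "(\<Sum>j\<in>{1..n}. real (sigma m E \<omega> {j}) * x j)
      = (\<Sum>j\<in>{1..n} - X. real (sigma m E \<omega> {j}) * x j) + (\<Sum>j\<in>X. real (sigma m E \<omega> {j}) * x j)"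
    using X by (intro sum.subset_diff) auto
  also have "(\<Sum>j\<in>{1..n} - X. real (sigma m E \<omega> {j}) * x j) = (\<Sum>j\<in>{1..n} - X. rho m E \<omega> j X * x j)"
    using rho_eq_sigma_singleton[where E = E and \<omega> = \<omega>, OF assms(1,2) fin] by (intro sum.cong) auto
  also have "(\<Sum>j\<in>X. real (sigma m E \<omega> {j}) * x j) \<le> (\<Sum>j\<in>X. real (sigma m E \<omega> {j}))"
    using X x by (intro sum_mono mult_left_le) auto
  also have "\<dots> = real (sigma m E \<omega> X)"
    by (simp add: sigma_eq_sum_singletons[where E = E and \<omega> = \<omega>, OF assms(1,2) fin])
  finally show ?thesis
    by simp
qed

lemma cut_empty:
  "real (sigma m E \<omega> {}) + (\<Sum>j\<in>{1..n} - {}. rho m E \<omega> j {} * x j)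
    = (\<Sum>j\<in>{1..n}. real (sigma m E \<omega> {j}) * x j)"
  by (simp add: rho_def sigma_def)

lemma arc_sum_binary:
  assumes "bipartite_arcs n m (E \<omega>)" "at_most_one_incoming m (E \<omega>)"
    and x: "\<And>j. j \<in> {1..n} \<Longrightarrow> x j \<in> {0, 1}"
  shows "(\<Sum>j\<in>{1..n}. arc_ind E \<omega> i j * x j) \<in> {0, 1}"
proof (cases "\<exists>k\<in>{1..n}. (k, i) \<in> E \<omega>")
  case True
  then obtain k where k: "k \<in> {1..n}" "(k, i) \<in> E \<omega>"
    by blast
  then have "arc_ind E \<omega> i j = (if k = j then 1 else 0)" for j
    using incoming_arc_unique[OF assms(1,2)] by (auto simp: arc_ind_def)
  then have "(\<Sum>j\<in>{1..n}. arc_ind E \<omega> i j * x j) = (\<Sum>j\<in>{1..n}. if k = j then x j else 0)"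
    by (intro sum.cong) auto
  also have "\<dots> = x k"
    using k(1) by simp
  finally show ?thesis
    using x[OF k(1)] by simp
next
  case False
  then show ?thesis
    by (auto simp: arc_ind_def intro: sum.neutral)
qed

lemma sigma_singleton_eq_sum_arc_ind:
  "real (sigma m E \<omega> {j}) = (\<Sum>i\<in>{1..m}. arc_ind E \<omega> i j)"
  by (simp add: sigma_def arc_ind_def flip: sum.inter_filter)

text \<open>
  Double counting of the arcs that leave the selected nodes: by head on the left, by tail on the right.
\<close>

lemma sum_arc_sums:
  "(\<Sum>i\<in>{1..m}. \<Sum>j\<in>{1..n}. arc_ind E \<omega> i j * x j)
    = (\<Sum>j\<in>{1..n}. real (sigma m E \<omega> {j}) * x j)"
  unfolding sigma_singleton_eq_sum_arc_ind sum_distrib_right by (rule sum.swap)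

theorem proposition3p9:
  fixes n m \<tau> :: nat
    and \<Omega> :: "'w set"
    and p :: "'w \<Rightarrow> real"
    and E :: "'w \<Rightarrow> (nat \<times> nat) set"
    and b :: "nat \<Rightarrow> real"
    and \<epsilon> :: real
  assumes "finite \<Omega>"
    and "\<forall>\<omega>\<in>\<Omega>. 0 \<le> p \<omega>"
    and "(\<Sum>\<omega>\<in>\<Omega>. p \<omega>) = 1"
    and "\<forall>\<omega>\<in>\<Omega>. bipartite_arcs n m (E \<omega>)"
    and "\<forall>\<omega>\<in>\<Omega>. at_most_one_incoming m (E \<omega>)"
    and "\<tau> \<le> m"
    and "0 \<le> \<epsilon>" and "\<epsilon> \<le> 1"
  shows "\<forall>x \<in> {1..n} \<rightarrow>\<^sub>E {0, 1}. \<forall>z \<in> \<Omega> \<rightarrow>\<^sub>E {0, 1}.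
      ((x, z) \<in> reduced_feasible n m \<Omega> p E \<tau> \<epsilon>
         \<longleftrightarrow> (\<exists>\<theta>. (x, \<theta>, z) \<in> master_feasible n m \<Omega> p E \<tau> \<epsilon>)) \<and>
      ((x, z) \<in> reduced_feasible n m \<Omega> p E \<tau> \<epsilon>
         \<longleftrightarrow> (\<exists>y. (x, y, z) \<in> det_equiv_feasible n m \<Omega> p E \<tau> \<epsilon>)) \<and>
      (\<forall>\<theta>. master_objective n b (x, \<theta>, z) = reduced_objective n b (x, z)) \<and>
      (\<forall>y. det_equiv_objective n b (x, y, z) = reduced_objective n b (x, z))"
proof (intro ballI)
  fix x :: "nat \<Rightarrow> real" and z :: "'w \<Rightarrow> real"
  assume x: "x \<in> {1..n} \<rightarrow>\<^sub>E {0, 1}" and z: "z \<in> \<Omega> \<rightarrow>\<^sub>E {0, 1}"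
  let ?L = "\<lambda>\<omega>. \<Sum>j\<in>{1..n}. real (sigma m E \<omega> {j}) * x j"
  let ?R = "(x, z) \<in> reduced_feasible n m \<Omega> p E \<tau> \<epsilon>"
  have x01: "x j \<in> {0, 1}" if "j \<in> {1..n}" for j
    using x that by (rule PiE_mem)
  have x_le: "x j \<le> 1" and x_ge: "0 \<le> x j" if "j \<in> {1..n}" for j
    using x01[OF that] by auto
  have R_iff: "?R \<longleftrightarrow> (\<forall>\<omega>\<in>\<Omega>. real \<tau> * z \<omega> \<le> ?L \<omega>) \<and> chance_constraint \<Omega> p \<epsilon> z"
    using x z by (simp add: reduced_feasible_def)

  have "?R \<longleftrightarrow> (\<exists>\<theta>. (x, \<theta>, z) \<in> master_feasible n m \<Omega> p E \<tau> \<epsilon>)"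
  proof
    assume ?R
    have "restrict ?L \<Omega> \<in> \<Omega> \<rightarrow>\<^sub>E {0..}"
      using x_ge by (auto intro!: sum_nonneg)
    moreover have "?L \<omega> \<le> real (sigma m E \<omega> X) + (\<Sum>j\<in>{1..n} - X. rho m E \<omega> j X * x j)"
      if "X \<subseteq> {1..n}" "\<omega> \<in> \<Omega>" for X \<omega>
      using that assms(4,5) x_le by (intro linear_form_le_cut) auto
    ultimately have "(x, restrict ?L \<Omega>, z) \<in> master_feasible n m \<Omega> p E \<tau> \<epsilon>"
      using \<open>?R\<close> x z unfolding R_iff master_feasible_def by simp
    then show "\<exists>\<theta>. (x, \<theta>, z) \<in> master_feasible n m \<Omega> p E \<tau> \<epsilon>"
      by blast
  next
    assume "\<exists>\<theta>. (x, \<theta>, z) \<in> master_feasible n m \<Omega> p E \<tau> \<epsilon>"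
    then obtain \<theta> where \<theta>: "(x, \<theta>, z) \<in> master_feasible n m \<Omega> p E \<tau> \<epsilon>" ..
    have "real \<tau> * z \<omega> \<le> ?L \<omega>" if "\<omega> \<in> \<Omega>" for \<omega>
    proof -
      have "real \<tau> * z \<omega> \<le> \<theta> \<omega>"
        using \<theta> that by (simp add: master_feasible_def)
      also have "\<theta> \<omega> \<le> real (sigma m E \<omega> {}) + (\<Sum>j\<in>{1..n} - {}. rho m E \<omega> j {} * x j)"
        using \<theta> that unfolding master_feasible_def by blast
      finally show ?thesis
        unfolding cut_empty .
    qed
    then show ?R
      using \<theta> unfolding R_iff by (simp add: master_feasible_def)
  qed

  moreover have "?R \<longleftrightarrow> (\<exists>y. (x, y, z) \<in> det_equiv_feasible n m \<Omega> p E \<tau> \<epsilon>)"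
  proof
    assume ?R
    define y where "y = (\<lambda>(i, \<omega>)\<in>{1..m} \<times> \<Omega>. \<Sum>j\<in>{1..n}. arc_ind E \<omega> i j * x j)"
    have y_eq: "y (i, \<omega>) = (\<Sum>j\<in>{1..n}. arc_ind E \<omega> i j * x j)" if "i \<in> {1..m}" "\<omega> \<in> \<Omega>" for i \<omega>
      using that by (simp add: y_def)
    have "y (i, \<omega>) \<in> {0, 1}" if "i \<in> {1..m}" "\<omega> \<in> \<Omega>" for i \<omega>
      unfolding y_eq[OF that] using that assms(4,5) x01 by (intro arc_sum_binary) auto
    then have "y \<in> {1..m} \<times> \<Omega> \<rightarrow>\<^sub>E {0, 1}"
      by (intro PiE_I) (metis SigmaE, auto simp: y_def)
    moreover have "(\<Sum>i\<in>{1..m}. y (i, \<omega>)) = ?L \<omega>" if "\<omega> \<in> \<Omega>" for \<omega>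
      unfolding sum_arc_sums[symmetric] using that by (intro sum.cong) (simp_all add: y_eq)
    ultimately have "(x, y, z) \<in> det_equiv_feasible n m \<Omega> p E \<tau> \<epsilon>"
      using \<open>?R\<close> x z y_eq unfolding R_iff det_equiv_feasible_def by simp
    then show "\<exists>y. (x, y, z) \<in> det_equiv_feasible n m \<Omega> p E \<tau> \<epsilon>"
      by blast
  next
    assume "\<exists>y. (x, y, z) \<in> det_equiv_feasible n m \<Omega> p E \<tau> \<epsilon>"
    then obtain y where y: "(x, y, z) \<in> det_equiv_feasible n m \<Omega> p E \<tau> \<epsilon>" ..
    have "real \<tau> * z \<omega> \<le> ?L \<omega>" if "\<omega> \<in> \<Omega>" for \<omega>
    proof -
      have "real \<tau> * z \<omega> \<le> (\<Sum>i\<in>{1..m}. y (i, \<omega>))"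
        using y that by (simp add: det_equiv_feasible_def)
      also have "\<dots> \<le> (\<Sum>i\<in>{1..m}. \<Sum>j\<in>{1..n}. arc_ind E \<omega> i j * x j)"
        using y that by (intro sum_mono) (simp add: det_equiv_feasible_def)
      finally show ?thesis
        unfolding sum_arc_sums .
    qed
    then show ?R
      using y unfolding R_iff by (simp add: det_equiv_feasible_def)
  qed

  ultimately show "(?R \<longleftrightarrow> (\<exists>\<theta>. (x, \<theta>, z) \<in> master_feasible n m \<Omega> p E \<tau> \<epsilon>)) \<and>
      (?R \<longleftrightarrow> (\<exists>y. (x, y, z) \<in> det_equiv_feasible n m \<Omega> p E \<tau> \<epsilon>)) \<and>
      (\<forall>\<theta>. master_objective n b (x, \<theta>, z) = reduced_objective n b (x, z)) \<and>
      (\<forall>y. det_equiv_objective n b (x, y, z) = reduced_objective n b (x, z))"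
    by (simp add: master_objective_def det_equiv_objective_def reduced_objective_def)
qed

end
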